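(* Let $d\ge2$ be an integer. The unique infinitely divisible monic polynomial $p$ of degree $d$ with $\kappa_1(p)=0$ and $\kappa_2(p)=1$ is $p(x)=d^{-d/2}H_d(\sqrt{d}\,x)$.
   Context: For a monic polynomial $p$ of degree $d$ write $p(x)=\sum_{i=0}^d (-1)^i a_i x^{d-i}$ ($a_0=1$), let $(d)_i=d(d-1)\cdots(d-i+1)$, and define the finite free cumulants $\kappa_1(p),\dots,\kappa_d(p)$ by $-\frac{1}{d}\frac{\partial}{\partial s}\ln\big(\sum_{i=0}^d \frac{(-d)^i a_i}{(d)_i}s^i\big)\equiv\sum_{j=0}^{d-1}\kappa_{j+1}(p)s^j \pmod{s^d}$. A monic degree-$d$ polynomial is determined by its finite free cumulants; for $t>0$, $p^{\boxplus_d t}$ denotes the monic degree-$d$ polynomial with $\kappa_n(p^{\boxplus_d t})=t\,\kappa_n(p)$, $n=1,\dots,d$. A monic polynomial $p$ with only real roots is infinitely divisible if $p^{\boxplus_d t}$ has only real roots for every $t>0$. $H_d$ is the Hermite polynomial $H_d(x)=d!\sum_{i=0}^{\lfloor d/2\rfloor}\frac{(-1)^i}{i!\,(d-2i)!}\frac{x^{d-2i}}{2^i}$. *)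

theory Defs
  imports "HOL-Analysis.Analysis" "HOL-Computational_Algebra.Computational_Algebra"
begin

text \<open>
  Polynomials are taken with complex coefficients, so that having only real roots is a
  condition on all complex roots.
\<close>

definition monic :: "complex poly \<Rightarrow> bool" where
  "monic p \<longleftrightarrow> lead_coeff p = 1"

definition only_real_roots :: "complex poly \<Rightarrow> bool" where
  "only_real_roots p \<longleftrightarrow> (\<forall>z. poly p z = 0 \<longrightarrow> z \<in> \<real>)"

text \<open>
  The coefficients \<open>a\<^sub>i\<close> in \<open>p(x) = (\<Sum>i\<le>d. (-1)^i * a\<^sub>i * x^(d - i))\<close>, where \<open>d\<close> is the degree
  of \<open>p\<close>; only meaningful for \<open>i \<le> d\<close>.
\<close>

definition signed_coeff :: "complex poly \<Rightarrow> nat \<Rightarrow> complex" where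
  "signed_coeff p i = (- 1) ^ i * coeff p (degree p - i)"

definition falling_fact :: "nat \<Rightarrow> nat \<Rightarrow> complex" where
  "falling_fact d i = (\<Prod>k<i. of_nat d - of_nat k)"

definition cumulant_series :: "complex poly \<Rightarrow> complex fps" where
  "cumulant_series p = (let d = degree p in
     Abs_fps (\<lambda>i. if i \<le> d then (- of_nat d) ^ i * signed_coeff p i / falling_fact d i else 0))"

text \<open>
  For monic \<open>p\<close>, \<open>cumulant_series p\<close> has constant term 1. As \<open>fps_ln 1\<close> is the power series of
  \<open>ln (1 + X)\<close>, the composition below is the formal logarithm of \<open>cumulant_series p\<close>.
  The value is only meaningful for \<open>1 \<le> n \<le> degree p\<close>.
\<close>

definition finite_free_cumulant :: "complex poly \<Rightarrow> nat \<Rightarrow> complex" where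
  "finite_free_cumulant p n =
     fps_nth (fps_const (- 1 / of_nat (degree p)) *
              fps_deriv (fps_ln 1 oo (cumulant_series p - 1))) (n - 1)"

lemma cumulant_series_nth_0: "monic p \<Longrightarrow> fps_nth (cumulant_series p) 0 = 1"
  by (simp add: cumulant_series_def signed_coeff_def falling_fact_def monic_def Let_def)

lemma deriv_ln_cumulant_series:
  assumes "monic p"
  shows "fps_deriv (fps_ln 1 oo (cumulant_series p - 1)) * cumulant_series p =
           fps_deriv (cumulant_series p)"
proof -
  define F where "F = cumulant_series p"
  have F0: "fps_nth F 0 = 1" using cumulant_series_nth_0[OF assms] by (simp add: F_def)
  have z: "fps_nth (F - 1) 0 = 0" using F0 by simp
  have "inverse (1 + fps_X :: complex fps) oo (F - 1) = inverse ((1 + fps_X) oo (F - 1))"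
    by (rule fps_inverse_compose[OF z]) simp
  also have "(1 + fps_X) oo (F - 1) = F"
    using z by (simp add: fps_compose_add_distrib)
  finally have i: "inverse (1 + fps_X :: complex fps) oo (F - 1) = inverse F" .
  have "fps_deriv (fps_ln 1 oo (F - 1)) = (fps_deriv (fps_ln 1) oo (F - 1)) * fps_deriv (F - 1)"
    by (rule fps_compose_deriv[OF z])
  also have "\<dots> = inverse F * fps_deriv F"
    by (simp add: fps_ln_deriv i)
  finally have e: "fps_deriv (fps_ln 1 oo (F - 1)) = inverse F * fps_deriv F" .
  have "inverse F * fps_deriv F * F = (inverse F * F) * fps_deriv F"
    by (simp only: mult_ac)
  also have "\<dots> = fps_deriv F"
    using F0 by (simp add: inverse_mult_eq_1)
  finally show ?thesis
    unfolding F_def[symmetric] e .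
qed

lemma cumulant_series_Suc:
  assumes "monic p" "degree p > 0"
  shows "of_nat (Suc n) * fps_nth (cumulant_series p) (Suc n) =
    (\<Sum>i=0..n. - of_nat (degree p) * finite_free_cumulant p (Suc i) * fps_nth (cumulant_series p) (n - i))"
proof -
  have "of_nat (Suc n) * fps_nth (cumulant_series p) (Suc n) =
      fps_nth (fps_deriv (fps_ln 1 oo (cumulant_series p - 1)) * cumulant_series p) n"
    by (subst deriv_ln_cumulant_series[OF assms(1)]) simp
  moreover have "fps_nth (fps_deriv (fps_ln 1 oo (cumulant_series p - 1))) i =
      - of_nat (degree p) * finite_free_cumulant p (Suc i)" for i
    using assms(2) by (simp add: finite_free_cumulant_def fps_mult_left_const_nth del: fps_deriv_nth)
  ultimately show ?thesis
    by (simp only: fps_mult_nth)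
qed

lemma falling_fact_nonzero: "i \<le> d \<Longrightarrow> falling_fact d i \<noteq> 0"
  by (auto simp: falling_fact_def)

text \<open>
  A monic polynomial of degree \<open>d\<close> is determined by its finite free cumulants, and these can be
  prescribed arbitrarily; hence the description in \<open>boxplus_power\<close> below is proper.
\<close>

lemma ex1_monic_cumulants:
  fixes c :: "nat \<Rightarrow> complex"
  assumes d: "d > 0"
  shows "\<exists>!q. monic q \<and> degree q = d \<and> (\<forall>n\<in>{1..d}. finite_free_cumulant q n = c n)"
proof (rule ex_ex1I)
  define L :: "complex fps" where "L = Abs_fps (\<lambda>j. - of_nat d * c (Suc j))"
  define F where "F = fps_exp 1 oo fps_integral L 0"
  have F0: "fps_nth F 0 = 1" by (simp add: F_def)
  have F': "fps_deriv F = L * F"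
    by (simp add: F_def fps_compose_deriv fps_deriv_fps_integral mult.commute)
  have FS: "of_nat (Suc n) * fps_nth F (Suc n) =
      (\<Sum>i=0..n. - of_nat d * c (Suc i) * fps_nth F (n - i))" for n
    using arg_cong[OF F', of "\<lambda>f. fps_nth f n"] by (simp add: fps_mult_nth L_def)
  define b where "b = (\<lambda>i. fps_nth F i * falling_fact d i / (of_nat d) ^ i)"
  define q where "q = (\<Sum>i\<le>d. monom (b i) (d - i))"
  have cq: "coeff q (d - i) = b i" if "i \<le> d" for i
  proof -
    have "coeff q (d - i) = (\<Sum>j\<le>d. if j = i then b j else 0)"
      unfolding q_def coeff_sum by (intro sum.cong refl) (use that in \<open>auto simp: coeff_monom\<close>)
    then show ?thesis using that by simp
  qed
  have b0: "b 0 = 1" using F0 by (simp add: b_def falling_fact_def)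
  have "degree q \<le> d" unfolding q_def
    by (intro degree_sum_le) (auto intro: order.trans[OF degree_monom_le])
  moreover have "coeff q d \<noteq> 0" using cq[of 0] b0 by simp
  ultimately have dq: "degree q = d" by (simp add: le_antisym le_degree)
  have mq: "monic q" using cq[of 0] b0 dq by (simp add: monic_def)
  have ser: "fps_nth (cumulant_series q) i = fps_nth F i" if "i \<le> d" for i
  proof -
    have "(- of_nat d) ^ i * ((- 1) ^ i :: complex) = of_nat d ^ i"
      by (simp flip: power_mult_distrib)
    then have "(- of_nat d) ^ i * signed_coeff q i = of_nat d ^ i * b i"
      using cq[OF that] by (simp add: signed_coeff_def dq flip: mult.assoc)
    then show ?thesis
      using that d falling_fact_nonzero[OF that]
      by (simp add: cumulant_series_def dq Let_def b_def)
  qed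
  have "finite_free_cumulant q (Suc n) = c (Suc n)" if "n < d" for n
    using that
  proof (induction n rule: less_induct)
    case (less n)
    have "(\<Sum>i=0..n. - of_nat d * finite_free_cumulant q (Suc i) * fps_nth F (n - i)) =
          (\<Sum>i=0..n. - of_nat d * finite_free_cumulant q (Suc i) * fps_nth (cumulant_series q) (n - i))"
      using less.prems by (intro sum.cong refl) (simp add: ser)
    also have "\<dots> = of_nat (Suc n) * fps_nth (cumulant_series q) (Suc n)"
      using cumulant_series_Suc[OF mq, of n] dq d by simp
    also have "\<dots> = of_nat (Suc n) * fps_nth F (Suc n)"
      using less.prems by (simp add: ser)
    also note FS
    finally have *: "(\<Sum>i\<in>{0..n}. - of_nat d * finite_free_cumulant q (Suc i) * fps_nth F (n - i)) =
      (\<Sum>i\<in>{0..n}. - of_nat d * c (Suc i) * fps_nth F (n - i))" .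
    have "{0..n} = insert n {0..<n}" by auto
    moreover have "(\<Sum>i\<in>{0..<n}. - of_nat d * finite_free_cumulant q (Suc i) * fps_nth F (n - i)) =
      (\<Sum>i\<in>{0..<n}. - of_nat d * c (Suc i) * fps_nth F (n - i))"
      using less by (intro sum.cong refl) simp
    ultimately show ?case using * F0 d by simp
  qed
  then have "\<forall>n\<in>{1..d}. finite_free_cumulant q n = c n"
    by (metis Suc_le_eq Suc_pred' atLeastAtMost_iff less_eq_Suc_le One_nat_def)
  then show "\<exists>q. monic q \<and> degree q = d \<and> (\<forall>n\<in>{1..d}. finite_free_cumulant q n = c n)"
    using mq dq by blast
next
  fix p q
  assume p: "monic p \<and> degree p = d \<and> (\<forall>n\<in>{1..d}. finite_free_cumulant p n = c n)"
    and q: "monic q \<and> degree q = d \<and> (\<forall>n\<in>{1..d}. finite_free_cumulant q n = c n)"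
  have ser: "fps_nth (cumulant_series p) n = fps_nth (cumulant_series q) n" if "n \<le> d" for n
    using that
  proof (induction n rule: less_induct)
    case (less n)
    show ?case
    proof (cases n)
      case 0
      then show ?thesis using p q cumulant_series_nth_0 by auto
    next
      case (Suc m)
      have "of_nat (Suc m) * fps_nth (cumulant_series p) (Suc m) =
            of_nat (Suc m) * fps_nth (cumulant_series q) (Suc m)"
        unfolding cumulant_series_Suc[OF conjunct1[OF p], unfolded p[THEN conjunct2, THEN conjunct1], OF d]
          cumulant_series_Suc[OF conjunct1[OF q], unfolded q[THEN conjunct2, THEN conjunct1], OF d]
        using less Suc p q by (intro sum.cong refl) simp
      then show ?thesis unfolding Suc by (subst (asm) mult_cancel_left) (simp del: of_nat_Suc)
    qed
  qed
  have *: "coeff p (d - i) = coeff q (d - i)" if "i \<le> d" for i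
    using ser[OF that] that d falling_fact_nonzero[OF that] p q
    by (simp add: cumulant_series_def signed_coeff_def Let_def)
  show "p = q"
  proof (rule poly_eqI)
    fix i
    show "coeff p i = coeff q i"
      using *[of "d - i"] p q by (cases "i \<le> d") (auto simp: coeff_eq_0)
  qed
qed

definition boxplus_power :: "complex poly \<Rightarrow> real \<Rightarrow> complex poly" where
  "boxplus_power p t = (THE q. monic q \<and> degree q = degree p \<and>
     (\<forall>n\<in>{1..degree p}. finite_free_cumulant q n = of_real t * finite_free_cumulant p n))"

definition infinitely_divisible :: "complex poly \<Rightarrow> bool" where
  "infinitely_divisible p \<longleftrightarrow>
     monic p \<and> only_real_roots p \<and> (\<forall>t>0. only_real_roots (boxplus_power p t))"

definition hermite_poly :: "nat \<Rightarrow> complex poly" where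
  "hermite_poly d = smult (fact d)
     (\<Sum>i\<le>d div 2. monom ((- 1) ^ i / (fact i * fact (d - 2 * i) * 2 ^ i)) (d - 2 * i))"

end

theory Submission
  imports Defs
begin

text \<open>
  Let \<open>F\<^sub>i(t)\<close> be the \<open>i\<close>-th coefficient of the cumulant series of the \<open>t\<close>-th power of \<open>p\<close>.
  If that power is real-rooted, then its roots have sum 0 and the sum of their squares is
  \<open>(d - 1) * t\<close>, so they are all \<open>O(sqrt t)\<close> and \<open>F\<^sub>i(t) = O(t powr (i / 2))\<close>. On the other hand,
  \<open>(n + 1) * F\<^sub>n\<^sub>+\<^sub>1(t) / t = - d * (\<Sum>i\<le>n. \<kappa>\<^sub>i\<^sub>+\<^sub>1 * F\<^sub>n\<^sub>-\<^sub>i(t))\<close>. As \<open>t \<rightarrow> 0\<close> the right-hand side tends to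
  \<open>- d * \<kappa>\<^sub>n\<^sub>+\<^sub>1\<close>, while for \<open>n \<ge> 2\<close> the left-hand side tends to 0; hence \<open>\<kappa>\<^sub>n\<^sub>+\<^sub>1 = 0\<close>.
  Conversely, the powers of the Hermite polynomial are again rescaled Hermite polynomials, whose
  real-rootedness follows from the recurrence \<open>H\<^sub>n\<^sub>+\<^sub>1 = x H\<^sub>n - \<sigma> H\<^sub>n'\<close>.
\<close>

section \<open>Hermite polynomials: coefficients and recurrence\<close>

text \<open>Hermite polynomials of variance \<open>\<sigma>\<close>; \<open>hermite_poly\<close> is the case \<open>\<sigma> = 1\<close>.\<close>

definition gen_hermite :: "complex \<Rightarrow> nat \<Rightarrow> complex poly" where
  "gen_hermite \<sigma> n =
     (\<Sum>i\<le>n div 2. monom ((- \<sigma> / 2) ^ i * fact n / (fact i * fact (n - 2 * i))) (n - 2 * i))"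

lemma coeff_gen_hermite:
  assumes "i \<le> n"
  shows "coeff (gen_hermite \<sigma> n) (n - i) =
    (if even i then (- \<sigma> / 2) ^ (i div 2) * fact n / (fact (i div 2) * fact (n - i)) else 0)"
proof -
  have "coeff (gen_hermite \<sigma> n) (n - i) = (\<Sum>j\<le>n div 2. if 2 * j = i then
          (- \<sigma> / 2) ^ j * fact n / (fact j * fact (n - i)) else 0)"
    unfolding gen_hermite_def coeff_sum
    by (intro sum.cong refl) (use assms in \<open>auto simp: coeff_monom\<close>)
  also have "\<dots> = (if even i then (- \<sigma> / 2) ^ (i div 2) * fact n / (fact (i div 2) * fact (n - i)) else 0)"
  proof (cases "even i")
    case True
    then have "(\<Sum>j\<le>n div 2. if 2 * j = i then (- \<sigma> / 2) ^ j * fact n / (fact j * fact (n - i)) else 0)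
       = (\<Sum>j\<le>n div 2. if j = i div 2 then (- \<sigma> / 2) ^ j * fact n / (fact j * fact (n - i)) else 0)"
      by (intro sum.cong refl) auto
    then show ?thesis using True assms by (simp add: div_le_mono)
  qed (auto intro!: sum.neutral)
  finally show ?thesis .
qed

lemma degree_gen_hermite_le: "degree (gen_hermite \<sigma> n) \<le> n"
  unfolding gen_hermite_def
  by (intro degree_sum_le) (auto intro: order.trans[OF degree_monom_le])

lemma degree_gen_hermite: "degree (gen_hermite \<sigma> n) = n"
  using coeff_gen_hermite[of 0 n \<sigma>] degree_gen_hermite_le[of \<sigma> n]
  by (intro antisym le_degree) auto

lemma monic_gen_hermite: "monic (gen_hermite \<sigma> n)"
  using coeff_gen_hermite[of 0 n \<sigma>] by (simp add: monic_def degree_gen_hermite)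

lemma coeff_gen_hermite_eq:
  "coeff (gen_hermite \<sigma> n) k = (if k \<le> n \<and> even (n - k)
     then (- \<sigma> / 2) ^ ((n - k) div 2) * fact n / (fact ((n - k) div 2) * fact k) else 0)"
  using coeff_gen_hermite[of "n - k" n \<sigma>] degree_gen_hermite[of \<sigma> n]
  by (cases "k \<le> n") (auto simp: coeff_eq_0)

lemma gen_hermite_Suc:
  "gen_hermite \<sigma> (Suc n) = pCons 0 (gen_hermite \<sigma> n) - smult \<sigma> (pderiv (gen_hermite \<sigma> n))"
proof (rule poly_eqI)
  fix k
  \<comment> \<open>In the first case both sides vanish, and in the second the derivative
    contributes nothing. In the third the derivative contributes, and so does the shifted polynomial
    unless \<open>k = 0\<close>, which is why \<open>k\<close> is split again there.\<close>
  consider "k > Suc n \<or> odd (Suc n - k)" | "k = Suc n" | j where "Suc n = k + 2 * Suc j"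
    by (metis Suc_leI antisym_conv2 dvd_def le_add_diff_inverse leI mult_zero_right
        add.right_neutral old.nat.exhaust)
  then show "coeff (gen_hermite \<sigma> (Suc n)) k =
      coeff (pCons 0 (gen_hermite \<sigma> n) - smult \<sigma> (pderiv (gen_hermite \<sigma> n))) k"
  proof cases
    case 1
    then show ?thesis
      by (auto simp: coeff_gen_hermite_eq coeff_pderiv coeff_pCons split: nat.splits)
  next
    case 2
    then show ?thesis
      by (simp add: coeff_gen_hermite_eq coeff_pderiv del: of_nat_Suc)
  next
    case (3 j)
    then have n: "n = Suc (k + 2 * j)" by simp
    have nz: "1 + of_nat a \<noteq> (0 :: complex)" "of_nat a + 2 \<noteq> (0 :: complex)"
      "1 + of_nat a * 2 \<noteq> (0 :: complex)" "2 + of_nat a * 2 \<noteq> (0 :: complex)" for a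
      using of_nat_neq_0[of a, where ?'a = complex] of_nat_neq_0[of "Suc a", where ?'a = complex]
        of_nat_neq_0[of "2 * a", where ?'a = complex] of_nat_neq_0[of "Suc (2 * a)", where ?'a = complex]
      by (simp_all add: algebra_simps)
    show ?thesis
    proof (cases k)
      case 0
      then show ?thesis unfolding n
        by (simp add: coeff_gen_hermite_eq coeff_pderiv divide_simps) (simp add: algebra_simps nz)
    next
      case (Suc m)
      then show ?thesis unfolding n
        by (simp add: coeff_gen_hermite_eq coeff_pderiv divide_simps) (simp add: algebra_simps nz)
    qed
  qed
qed

section \<open>Real-rootedness of Hermite polynomials\<close>

text \<open>The logarithmic derivative is the sum of \<open>1 / (z - x)\<close> over the roots, and
  for real \<open>x\<close> each term has imaginary part of sign opposite to that of
  \<open>z\<close>. The inequality is weak because \<open>A\<close> may be empty.\<close>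

lemma Im_log_deriv_real_roots:
  assumes "\<forall>x\<in>#A. x \<in> \<real>" "Im z \<noteq> 0"
  defines "P \<equiv> (\<Prod>x\<in>#A. [:- x, 1:])"
  shows "poly P z \<noteq> 0 \<and> Im z * Im (poly (pderiv P) z / poly P z) \<le> 0"
  using assms(1) unfolding P_def
proof (induction A)
  case (add x A)
  define Q where "Q = (\<Prod>x\<in>#A. [:- x, 1:])"
  have IH: "poly Q z \<noteq> 0" "Im z * Im (poly (pderiv Q) z / poly Q z) \<le> 0"
    using add by (auto simp: Q_def)
  have x: "z \<noteq> x" "Im x = 0" using add.prems assms(2) by (auto simp: complex_is_Real_iff)
  have "poly (pderiv ([:- x, 1:] * Q)) z / poly ([:- x, 1:] * Q) z =
      1 / (z - x) + poly (pderiv Q) z / poly Q z"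
    using IH x by (simp add: pderiv_mult pderiv_pCons divide_simps del: mult_pCons_left)
  moreover have "Im z * Im (1 / (z - x)) \<le> 0"
    using x by (simp add: Im_divide zero_le_divide_iff)
  ultimately show ?case
    using IH x by (simp add: Q_def[symmetric] algebra_simps)
qed auto

lemma monic_factorization:
  assumes "monic p"
  obtains A where "size A = degree p" "p = (\<Prod>x\<in>#A. [:- x, 1:])" "\<And>x. x \<in># A \<Longrightarrow> poly p x = 0"
proof -
  have "p \<noteq> 0" using assms by (auto simp: monic_def)
  from alg_closed_imp_factorization[OF this] obtain A where
    A: "size A = degree p" "p = smult (lead_coeff p) (\<Prod>x\<in>#A. [:- x, 1:])" by blast
  have e: "p = (\<Prod>x\<in>#A. [:- x, 1:])" using A(2) assms by (simp add: monic_def)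
  moreover have "poly p x = 0" if "x \<in># A" for x
    using that unfolding e by (auto simp: poly_prod_mset prod_mset_zero_iff)
  ultimately show ?thesis using that A(1) by blast
qed

text \<open>
  At a non-real root \<open>z\<close> of \<open>x P - \<sigma> P'\<close> we have \<open>z = \<sigma> P'(z) / P(z)\<close>, but the imaginary parts
  of the two sides have opposite signs.
\<close>

lemma only_real_roots_gen_hermite:
  assumes "\<sigma> > 0"
  shows "only_real_roots (gen_hermite (of_real \<sigma>) n)"
proof (induction n)
  case 0
  then show ?case by (simp add: gen_hermite_def only_real_roots_def)
next
  case (Suc n)
  define P where "P = gen_hermite (of_real \<sigma>) n"
  obtain A where A: "P = (\<Prod>x\<in>#A. [:- x, 1:])" "\<And>x. x \<in># A \<Longrightarrow> poly P x = 0"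
    unfolding P_def using monic_factorization[OF monic_gen_hermite] by metis
  have real: "\<forall>x\<in>#A. x \<in> \<real>"
    using A(2) Suc by (auto simp: only_real_roots_def P_def)
  show ?case unfolding only_real_roots_def
  proof (intro allI impI)
    fix z assume "poly (gen_hermite (of_real \<sigma>) (Suc n)) z = 0"
    then have z: "z * poly P z = of_real \<sigma> * poly (pderiv P) z"
      by (simp add: gen_hermite_Suc P_def)
    show "z \<in> \<real>"
    proof (rule ccontr)
      assume "z \<notin> \<real>"
      then have Im: "Im z \<noteq> 0" by (simp add: complex_is_Real_iff)
      note L = Im_log_deriv_real_roots[OF real Im, folded A(1)]
      then have "z = of_real \<sigma> * (poly (pderiv P) z / poly P z)"
        using z by (simp add: divide_simps)
      then have "Im z = \<sigma> * Im (poly (pderiv P) z / poly P z)"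
        by (metis Im_complex_of_real Re_complex_of_real add.right_neutral mult_zero_left times_complex.sel(2))
      then have "Im z * Im z = \<sigma> * (Im z * Im (poly (pderiv P) z / poly P z))"
        by (metis mult.left_commute)
      also have "\<dots> \<le> 0" using L assms by (simp add: mult_nonneg_nonpos)
      finally have "(Im z)\<^sup>2 \<le> 0" by (simp add: power2_eq_square)
      then show False using Im by simp
    qed
  qed
qed

section \<open>Cumulants and convolution powers of Hermite polynomials\<close>

lemma falling_fact_eq: "i \<le> d \<Longrightarrow> falling_fact d i = fact d / fact (d - i)"
proof (induction i)
  case (Suc i)
  then have *: "fact (d - i) = (of_nat (d - i) * fact (d - Suc i) :: complex)"
    by (metis Suc_diff_Suc Suc_le_lessD fact_Suc of_nat_fact of_nat_mult)
  have "falling_fact d (Suc i) = falling_fact d i * of_nat (d - i)"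
    using Suc.prems by (simp add: falling_fact_def of_nat_diff)
  also have "\<dots> = fact d / fact (d - Suc i)"
    using Suc * by simp
  finally show ?case .
qed (simp add: falling_fact_def)

lemma coeff_cumulant_series:
  assumes "i \<le> degree p" "degree p > 0"
  shows "coeff p (degree p - i) =
    fps_nth (cumulant_series p) i * falling_fact (degree p) i / of_nat (degree p) ^ i"
proof -
  have "(- of_nat (degree p)) ^ i * ((- 1) ^ i :: complex) = of_nat (degree p) ^ i"
    by (simp flip: power_mult_distrib)
  then have "(- of_nat (degree p)) ^ i * signed_coeff p i = of_nat (degree p) ^ i * coeff p (degree p - i)"
    by (simp add: signed_coeff_def flip: mult.assoc)
  then show ?thesis
    using assms falling_fact_nonzero[OF assms(1)] by (simp add: cumulant_series_def Let_def)
qed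

text \<open>If only the second cumulant is nonzero, the logarithmic derivative of the cumulant
  series is \<open>- d * t * s\<close> up to order \<open>d\<close>, so the series agrees with
  \<open>exp (- d * t * s^2 / 2)\<close> up to \<open>s^d\<close>. Its coefficients are those of a
  Hermite polynomial of variance \<open>t / d\<close>.\<close>

lemma gaussian_cumulants_imp_gen_hermite:
  assumes q: "monic q" "degree q = d" "d > 0"
    and c: "\<forall>n\<in>{1..d}. finite_free_cumulant q n = (if n = 2 then t else 0)"
  shows "q = gen_hermite (t / of_nat d) d"
proof -
  define F where "F = fps_nth (cumulant_series q)"
  have F0: "F 0 = 1" using cumulant_series_nth_0[OF q(1)] by (simp add: F_def)
  have rec: "of_nat (Suc n) * F (Suc n) = (if n = 0 then 0 else - of_nat d * t * F (n - 1))"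
    if "n < d" for n
  proof -
    have "of_nat (Suc n) * F (Suc n) =
        (\<Sum>i=0..n. - of_nat d * finite_free_cumulant q (Suc i) * F (n - i))"
      using cumulant_series_Suc[OF q(1), of n] q by (simp add: F_def)
    \<comment> \<open>Summand \<open>i\<close> carries the cumulant of order \<open>i + 1\<close>,
      so only \<open>i = 1\<close> survives.\<close>
    also have "\<dots> = (\<Sum>i=0..n. if i = 1 then - of_nat d * t * F (n - i) else 0)"
      using c that by (intro sum.cong refl) auto
    also have "\<dots> = (if n = 0 then 0 else - of_nat d * t * F (n - 1))" by simp
    finally show ?thesis .
  qed
  have F: "F n = (if even n then (- of_nat d * t / 2) ^ (n div 2) / fact (n div 2) else 0)"
    if "n \<le> d" for n
    using that
  proof (induction n rule: less_induct)
    case (less n)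
    consider "n = 0" | "n = 1" | m where "n = Suc (Suc m)"
      by (metis One_nat_def old.nat.exhaust)
    then show ?case
    proof cases
      case 1 then show ?thesis by (simp add: F0)
    next
      case 2 then show ?thesis using rec[of 0] less.prems by simp
    next
      case (3 m)
      have "of_nat (Suc (Suc m)) * F n = - of_nat d * t * F m"
        using rec[of "Suc m"] less.prems 3 by simp
      then have "F n = - of_nat d * t * F m / of_nat (Suc (Suc m))"
        by (metis nonzero_mult_div_cancel_left of_nat_eq_0_iff old.nat.distinct(1))
      moreover have "of_nat (Suc (Suc m)) = (2 * of_nat (Suc (m div 2)) :: complex)" if "even m"
      proof -
        obtain k where "m = 2 * k" using \<open>even m\<close> by blast
        then show ?thesis by simp
      qed
      ultimately show ?thesis using less.IH[of m] less.prems 3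
        by (auto simp: field_simps simp del: of_nat_Suc)
    qed
  qed
  have "coeff q (d - i) = coeff (gen_hermite (t / of_nat d) d) (d - i)" if "i \<le> d" for i
  proof (cases "even i")
    case True
    then obtain j where j: "i = 2 * j" by blast
    \<comment> \<open>Since \<open>i = 2 * j\<close>, each of the \<open>j\<close> factors is
      divided by \<open>d^2\<close>.\<close>
    have scale: "(- of_nat d * t / 2) ^ j / of_nat d ^ i = (- (t / of_nat d) / 2) ^ j"
      unfolding j power_mult power_divide[symmetric] using q(3) by (simp add: power2_eq_square mult.commute)
    have "coeff q (d - i) =
        (- of_nat d * t / 2) ^ j / of_nat d ^ i * (fact d / (fact j * fact (d - i)))"
      using coeff_cumulant_series[of i q] that q F[OF that] j
      by (simp add: falling_fact_eq F_def[symmetric])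
    then show ?thesis unfolding scale using that j by (simp add: coeff_gen_hermite)
  next
    case False
    then show ?thesis
      using coeff_cumulant_series[of i q] that q F[OF that]
      by (simp add: coeff_gen_hermite F_def[symmetric])
  qed
  then have "coeff q k = coeff (gen_hermite (t / of_nat d) d) k" if "k \<le> d" for k
    using that by (metis diff_diff_cancel diff_le_self)
  then show ?thesis
    using q(2) degree_gen_hermite by (metis coeff_eq_0 leI poly_eqI)
qed

lemma gen_hermite_cumulants:
  assumes "d > 0" "n \<in> {1..d}"
  shows "finite_free_cumulant (gen_hermite (t / of_nat d) d) n = (if n = 2 then t else 0)"
proof -
  obtain q where "monic q" "degree q = d"
    "\<forall>n\<in>{1..d}. finite_free_cumulant q n = (if n = 2 then t else 0)"
    using ex1_implies_ex[OF ex1_monic_cumulants[OF assms(1), of "\<lambda>n. if n = 2 then t else 0"]] by blast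
  with gaussian_cumulants_imp_gen_hermite[of q d t] assms show ?thesis by blast
qed

lemma boxplus_power:
  assumes "degree p > 0"
  shows monic_boxplus_power: "monic (boxplus_power p t)"
    and degree_boxplus_power: "degree (boxplus_power p t) = degree p"
    and cumulant_boxplus_power: "n \<in> {1..degree p} \<Longrightarrow>
      finite_free_cumulant (boxplus_power p t) n = of_real t * finite_free_cumulant p n"
  using theI'[OF ex1_monic_cumulants[OF assms, of "\<lambda>n. of_real t * finite_free_cumulant p n"],
      folded boxplus_power_def]
  by auto

lemma infinitely_divisible_gen_hermite:
  assumes "d > 0" "\<sigma> > 0"
  shows "infinitely_divisible (gen_hermite (of_real \<sigma>) d)"
proof -
  define p where "p = gen_hermite (of_real \<sigma>) d"
  \<comment> \<open>Variance is the second cumulant divided by \<open>d\<close>, so \<open>p\<close>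
    has second cumulant \<open>d * \<sigma>\<close>.\<close>
  have p: "p = gen_hermite (of_real (d * \<sigma>) / of_nat d) d" using assms by (simp add: p_def)
  have "boxplus_power p t = gen_hermite (of_real (t * d * \<sigma>) / of_nat d) d" for t
    using boxplus_power[where p = p and t = t] assms
      gen_hermite_cumulants[of d _ "of_real (d * \<sigma>)", folded p]
      degree_gen_hermite[of "of_real \<sigma>" d, folded p_def]
    by (intro gaussian_cumulants_imp_gen_hermite) auto
  then have "boxplus_power p t = gen_hermite (of_real (t * \<sigma>)) d" for t
    using assms by simp
  then show ?thesis unfolding infinitely_divisible_def p_def
    using assms only_real_roots_gen_hermite monic_gen_hermite by (metis p_def mult_pos_pos)
qed

text \<open>The coefficient of \<open>x^(d - 2 * i)\<close> is multiplied by
  \<open>d^(-d/2) * d^((d - 2 * i)/2) = d^(-i)\<close>, which changes the variance from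
  \<open>1\<close> to \<open>1 / d\<close>.\<close>

lemma rescaled_hermite_poly:
  assumes "d > 0"
  shows "smult (of_real (real d powr (- real d / 2)))
           (pcompose (hermite_poly d) [:0, of_real (sqrt (real d)):]) = gen_hermite (1 / of_nat d) d"
proof -
  have scale: "real d powr (- real d / 2) * sqrt (real d) ^ (d - 2 * i) = (1 / real d) ^ i"
    if "2 * i \<le> d" for i
  proof -
    have "sqrt (real d) ^ (d - 2 * i) = real d powr ((real d - 2 * real i) / 2)"
      using assms that by (simp add: powr_half_sqrt[symmetric] powr_powr of_nat_diff flip: powr_realpow)
    then have "real d powr (- real d / 2) * sqrt (real d) ^ (d - 2 * i) = real d powr (- real i)"
      by (simp add: diff_divide_distrib flip: powr_add)
    then show ?thesis using assms by (simp add: powr_minus powr_realpow field_simps)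
  qed
  have half: "(- (1 / 2)) ^ i = ((- 1) ^ i / 2 ^ i :: complex)" for i
    using power_divide[of "- 1 :: complex" 2 i] by simp
  have H: "hermite_poly d = gen_hermite 1 d"
    unfolding hermite_poly_def gen_hermite_def
    by (rule poly_eqI) (simp add: coeff_sum sum_distrib_left coeff_monom power_divide,
      intro sum.cong, auto simp: half field_simps)
  show ?thesis
  proof (rule poly_eqI)
    fix k
    show "coeff (smult (of_real (real d powr (- real d / 2)))
           (pcompose (hermite_poly d) [:0, of_real (sqrt (real d)):])) k = coeff (gen_hermite (1 / of_nat d) d) k"
    proof (cases "k \<le> d \<and> even (d - k)")
      case True
      then obtain i where i: "d - k = 2 * i" by blast
      then have k: "k = d - 2 * i" "2 * i \<le> d" using True by auto
      have "complex_of_real (real d powr (- real d / 2)) * of_real (sqrt (real d)) ^ k = (1 / of_nat d) ^ i"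
        using arg_cong[OF scale[OF k(2)], of complex_of_real] by (simp add: k(1))
      moreover have "(- (1 / of_nat d) / 2 :: complex) ^ i = (1 / of_nat d) ^ i * (- 1 / 2) ^ i"
        by (simp flip: power_mult_distrib)
      moreover have "(d - k) div 2 = i" using i by simp
      ultimately show ?thesis
        using True by (simp add: H coeff_pcompose_linear coeff_gen_hermite_eq flip: mult.assoc)
    qed (auto simp: H coeff_pcompose_linear coeff_gen_hermite_eq)
  qed
qed

section \<open>Coefficient bounds for polynomials with real roots\<close>

text \<open>With the coefficients in reversed order, the \<open>i\<close>-th one is
  \<open>(- 1)^i\<close> times the \<open>i\<close>-th elementary symmetric function of
  \<open>A\<close>, so inductions over \<open>A\<close> need no index shift by its size.\<close>

lemma coeff_prod_linear_Suc:
  "coeff (\<Prod>x\<in>#add_mset a A. [:1, - x:]) (Suc i) =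
     coeff (\<Prod>x\<in>#A. [:1, - x:]) (Suc i) - a * coeff (\<Prod>x\<in>#A. [:1, - x:]) i" for a :: "'a :: comm_ring_1"
  by (simp add: coeff_pCons)

lemma coeff_prod_linear_0: "coeff (\<Prod>x\<in>#A. [:1, - x:]) 0 = (1 :: 'a :: comm_ring_1)"
  by (induction A) auto

lemma coeff_prod_linear_1: "coeff (\<Prod>x\<in>#A. [:1, - x:]) 1 = - (\<Sum>x\<in>#A. x :: 'a :: comm_ring_1)"
proof (induction A)
  case (add a A)
  then show ?case
    using coeff_prod_linear_Suc[of a A 0] by (simp add: coeff_prod_linear_0 del: mult_pCons_left)
qed simp

text \<open>Newton's identity for the second power sum.\<close>

lemma coeff_prod_linear_2:
  "2 * coeff (\<Prod>x\<in>#A. [:1, - x:]) 2 = (\<Sum>x\<in>#A. x)\<^sup>2 - (\<Sum>x\<in>#A. x\<^sup>2 :: 'a :: comm_ring_1)"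
proof (induction A)
  case (add a A)
  have "coeff (\<Prod>x\<in>#add_mset a A. [:1, - x:]) 2 =
     coeff (\<Prod>x\<in>#A. [:1, - x:]) 2 + a * (\<Sum>x\<in>#A. x)"
    using coeff_prod_linear_Suc[of a A 1] coeff_prod_linear_1[of A]
    by (simp add: numeral_2_eq_2 del: mult_pCons_left)
  then show ?case using add by (simp add: algebra_simps power2_eq_square)
qed auto

text \<open>One more factor adds to each coefficient at most \<open>r\<close> times the norm of the
  preceding one, which at most doubles the bound.\<close>

lemma norm_coeff_prod_linear_le:
  fixes A :: "'a :: real_normed_field multiset"
  assumes "\<forall>x\<in>#A. norm x \<le> r" "r \<ge> 0"
  shows "norm (coeff (\<Prod>x\<in>#A. [:1, - x:]) i) \<le> 2 ^ size A * r ^ i"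
  using assms(1)
proof (induction A arbitrary: i)
  case empty
  then show ?case using assms(2) by (cases i) auto
next
  case (add a A)
  show ?case
  proof (cases i)
    case 0
    show ?thesis unfolding 0 coeff_prod_linear_0 using one_le_power[of "2::real" "Suc (size A)"] by simp
  next
    case (Suc j)
    let ?R = "\<Prod>x\<in>#A. [:1, - x:]"
    have "norm (coeff (\<Prod>x\<in>#add_mset a A. [:1, - x:]) i) \<le> norm (coeff ?R i) + norm a * norm (coeff ?R j)"
      unfolding Suc coeff_prod_linear_Suc norm_mult[symmetric] by (rule norm_triangle_ineq4)
    also have "\<dots> \<le> 2 ^ size A * r ^ i + r * (2 ^ size A * r ^ j)"
      using add.prems assms(2) by (intro add_mono mult_mono add.IH) auto
    finally show ?thesis by (simp add: Suc mult_ac)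
  qed
qed

text \<open>By Newton's identity the squares of the roots sum to \<open>2 * b\<close>. As the roots
  are real, each has absolute value at most \<open>sqrt (2 * b)\<close>, which bounds the
  coefficients.\<close>

lemma norm_coeff_real_rooted_le:
  assumes p: "monic p" "only_real_roots p" "degree p = d" "d \<ge> 2"
    and c: "coeff p (d - 1) = 0" "coeff p (d - 2) = of_real (- b)" and i: "i \<le> d"
  shows "norm (coeff p (d - i)) \<le> 2 ^ d * sqrt (2 * b) ^ i"
proof -
  obtain A where A: "size A = degree p" "p = (\<Prod>x\<in>#A. [:- x, 1:])" "\<And>x. x \<in># A \<Longrightarrow> poly p x = 0"
    using monic_factorization[OF p(1)] by metis
  have real: "\<forall>x\<in>#A. x \<in> \<real>" using A(3) p(2) by (auto simp: only_real_roots_def)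
  have refl_linear: "reflect_poly [:- x, 1:] = [:1, - x:]" for x :: complex
    by (rule poly_eqI) (auto simp: coeff_reflect_poly coeff_pCons split: nat.splits)
  have refl_p: "reflect_poly p = (\<Prod>x\<in>#A. [:1, - x:])" unfolding A(2)
    by (induction A) (simp_all add: reflect_poly_mult refl_linear del: mult_pCons_left)
  have R: "coeff p (d - k) = coeff (\<Prod>x\<in>#A. [:1, - x:]) k" if "k \<le> d" for k
    using that p(3) by (simp add: coeff_reflect_poly flip: refl_p)
  have S1: "(\<Sum>x\<in>#A. x) = 0" using R[of 1] c(1) p(4) coeff_prod_linear_1[of A] by simp
  have "coeff (\<Prod>x\<in>#A. [:1, - x:]) 2 = of_real (- b)" using R[of 2] c(2) p(4) by simp
  then have S: "(\<Sum>x\<in>#A. x\<^sup>2) = of_real (2 * b)"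
    using coeff_prod_linear_2[of A] S1 by simp
  \<comment> \<open>Real-rootedness enters here: squares of real roots are squared norms, so they
    cannot cancel.\<close>
  have "(\<Sum>x\<in>#A. x\<^sup>2) = of_real (\<Sum>x\<in>#A. (norm x)\<^sup>2)"
    using real by (induction A) (auto elim!: Reals_cases simp flip: of_real_power)
  then have S': "(\<Sum>x\<in>#A. (norm x)\<^sup>2) = 2 * b" using S by (metis of_real_eq_iff)
  have nonneg: "(\<Sum>x\<in>#B. (norm x)\<^sup>2) \<ge> 0" for B :: "complex multiset"
    by (induction B) auto
  have "norm x \<le> sqrt (2 * b)" if "x \<in># A" for x
  proof -
    obtain B where "A = add_mset x B" using multi_member_split \<open>x \<in># A\<close> by metis
    then have "(norm x)\<^sup>2 \<le> 2 * b" using S' nonneg[of B] by simp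
    then show ?thesis by (rule real_le_rsqrt)
  qed
  moreover have "b \<ge> 0" using S' nonneg[of A] by simp
  ultimately show ?thesis
    using norm_coeff_prod_linear_le[of A "sqrt (2 * b)" i] R[OF i] A(1) p(3) by simp
qed

section \<open>Vanishing of the cumulants of order at least three\<close>

lemma infinitely_divisible_higher_cumulants:
  assumes p: "infinitely_divisible p" "degree p = d" "d \<ge> 2"
    and c: "finite_free_cumulant p 1 = 0" "finite_free_cumulant p 2 = 1"
    and n: "2 \<le> n" "n < d"
  shows "finite_free_cumulant p (Suc n) = 0"
proof -
  define \<kappa> where "\<kappa> = finite_free_cumulant p"
  \<comment> \<open>The substitution \<open>t = s\<^sup>2\<close> avoids the half-integer powers of \<open>t\<close>.\<close>
  define q where "q = (\<lambda>s. boxplus_power p (s\<^sup>2))"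
  define F where "F = (\<lambda>s. fps_nth (cumulant_series (q s)))"
  have q: "monic (q s)" "degree (q s) = d" for s
    using boxplus_power[where p = p and t = "s\<^sup>2"] p by (auto simp: q_def)
  have F0: "F s 0 = 1" for s
    using cumulant_series_nth_0[OF q(1)] by (simp add: F_def)
  have rec: "of_nat (Suc m) * F s (Suc m) =
      - of_nat d * of_real (s\<^sup>2) * (\<Sum>i=0..m. \<kappa> (Suc i) * F s (m - i))" if "m < d" for m s
  proof -
    have "of_nat (Suc m) * F s (Suc m) =
        (\<Sum>i=0..m. - of_nat d * finite_free_cumulant (q s) (Suc i) * F s (m - i))"
      using cumulant_series_Suc[OF q(1), of s m] q p by (simp add: F_def)
    also have "\<dots> = (\<Sum>i=0..m. - of_nat d * of_real (s\<^sup>2) * (\<kappa> (Suc i) * F s (m - i)))"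
      using that p cumulant_boxplus_power[where p = p and t = "s\<^sup>2"]
      by (intro sum.cong refl) (auto simp: q_def \<kappa>_def)
    finally show ?thesis by (simp add: sum_distrib_left)
  qed
  have F1: "F s 1 = 0" for s using rec[of 0 s] c p by (simp add: \<kappa>_def)
  have F2: "F s 2 = - of_nat d * of_real (s\<^sup>2) / 2" for s
    using rec[of 1 s] c p F0 F1 by (simp add: \<kappa>_def numeral_2_eq_2 field_simps)
  \<comment> \<open>The factor \<open>2 ^ d\<close> comes from the coefficient bound,
    \<open>sqrt (real d) ^ i\<close> from the root bound \<open>sqrt (real d) * s\<close>, and the
    remaining quotient from passing from coefficients of \<open>q s\<close> to
    \<open>F s\<close>.\<close>
  define C where "C = (\<lambda>i. 2 ^ d * sqrt (real d) ^ i * real d ^ i / norm (falling_fact d i))"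
  have falling_fact_2: "falling_fact d 2 = of_nat d * of_nat (d - 1)"
    using p by (simp add: falling_fact_def numeral_2_eq_2 of_nat_diff)
  have bound: "norm (F s i) \<le> C i * s ^ i" if s: "s > 0" and i: "i \<le> d" for s i
  proof -
    have "only_real_roots (q s)" using p(1) s by (simp add: infinitely_divisible_def q_def)
    moreover have coeff: "coeff (q s) (d - k) = F s k * falling_fact d k / of_nat d ^ k" if "k \<le> d" for k
      using coeff_cumulant_series[of k "q s"] q[of s] that p by (simp add: F_def)
    moreover have "coeff (q s) (d - 2) = of_real (- (real (d - 1) * s\<^sup>2 / 2))"
      using coeff[of 2] p by (simp add: F2 falling_fact_2 power2_eq_square)
    ultimately have "norm (coeff (q s) (d - i)) \<le> 2 ^ d * sqrt (2 * (real (d - 1) * s\<^sup>2 / 2)) ^ i"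
      using q[of s] p i F1[of s] by (intro norm_coeff_real_rooted_le) auto
    also have "sqrt (2 * (real (d - 1) * s\<^sup>2 / 2)) \<le> sqrt (real d) * s"
      using s by (simp add: real_sqrt_mult mult_right_mono)
    then have "2 ^ d * sqrt (2 * (real (d - 1) * s\<^sup>2 / 2)) ^ i \<le> 2 ^ d * (sqrt (real d) * s) ^ i"
      by (intro mult_left_mono power_mono) auto
    finally have "norm (F s i) * norm (falling_fact d i) / real d ^ i \<le> 2 ^ d * (sqrt (real d) * s) ^ i"
      using coeff[OF i] by (simp add: norm_mult norm_divide norm_power)
    then show ?thesis using falling_fact_nonzero[OF i] p
      by (simp add: C_def field_simps power_mult_distrib)
  qed
  have lim_s: "((\<lambda>s. C i * s ^ k) \<longlongrightarrow> 0) (at_right (0::real))" if "k > 0" for i k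
    using that by (auto intro!: tendsto_eq_intros)
  have lim_F: "((\<lambda>s. F s k) \<longlongrightarrow> (if k = 0 then 1 else 0)) (at_right 0)" if "k \<le> d" for k
  proof (cases "k = 0")
    case False
    then show ?thesis
      using bound[OF _ that]
      by (auto intro!: Lim_null_comparison[OF _ lim_s[of k k]] simp: eventually_at_filter)
  qed (simp add: F0)
  \<comment> \<open>Only \<open>F s 0\<close> has a nonzero limit, so the convolution tends to its
    last term.\<close>
  have "((\<lambda>s. \<Sum>i=0..n. \<kappa> (Suc i) * F s (n - i)) \<longlongrightarrow>
      (\<Sum>i=0..n. \<kappa> (Suc i) * (if n - i = 0 then 1 else 0))) (at_right 0)"
    using n by (intro tendsto_intros lim_F) auto
  also have "(\<Sum>i=0..n. \<kappa> (Suc i) * (if n - i = 0 then 1 else 0)) = (\<Sum>i=0..n. if i = n then \<kappa> (Suc i) else 0)"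
    by (intro sum.cong refl) auto
  finally have "((\<lambda>s. - of_nat d * (\<Sum>i=0..n. \<kappa> (Suc i) * F s (n - i))) \<longlongrightarrow> - of_nat d * \<kappa> (Suc n)) (at_right 0)"
    by (intro tendsto_intros) simp
  moreover have "((\<lambda>s. - of_nat d * (\<Sum>i=0..n. \<kappa> (Suc i) * F s (n - i))) \<longlongrightarrow> 0) (at_right 0)"
  proof (rule Lim_null_comparison)
    \<comment> \<open>Dividing the bound of order \<open>s ^ Suc n\<close> by \<open>s^2\<close>
      leaves \<open>s ^ (n - 1)\<close>, which tends to 0 because \<open>n \<ge> 2\<close>. For
      \<open>n = 1\<close> the exponent would be 0, in keeping with the second cumulant being
      1.\<close>
    show "((\<lambda>s. real (Suc n) * (C (Suc n) * s ^ (n - 1))) \<longlongrightarrow> 0) (at_right 0)"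
      using lim_s[of "n - 1" "Suc n"] n by (intro tendsto_mult_right_zero) auto
    have "norm (- of_nat d * (\<Sum>i=0..n. \<kappa> (Suc i) * F s (n - i))) \<le> real (Suc n) * (C (Suc n) * s ^ (n - 1))"
      if s: "s > 0" for s
    proof -
      let ?S = "- of_nat d * (\<Sum>i=0..n. \<kappa> (Suc i) * F s (n - i))"
      have "of_real (s\<^sup>2) * ?S = of_nat (Suc n) * F s (Suc n)"
        using rec[OF n(2), of s] by (simp add: mult_ac)
      then have "s\<^sup>2 * norm ?S = real (Suc n) * norm (F s (Suc n))"
        by (metis norm_mult norm_of_nat norm_of_real abs_power2)
      also have "\<dots> \<le> real (Suc n) * (C (Suc n) * s ^ Suc n)"
        using bound[OF s, of "Suc n"] n by (intro mult_left_mono) auto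
      also have "s ^ Suc n = s\<^sup>2 * s ^ (n - 1)"
        using n by (simp flip: power_add)
      finally show ?thesis using s by simp
    qed
    then show "\<forall>\<^sub>F s in at_right 0. norm (- of_nat d * (\<Sum>i=0..n. \<kappa> (Suc i) * F s (n - i))) \<le> real (Suc n) * (C (Suc n) * s ^ (n - 1))"
      by (simp add: eventually_at_filter)
  qed
  ultimately have "- of_nat d * \<kappa> (Suc n) = 0"
    using tendsto_unique[OF trivial_limit_at_right_real] by blast
  then show ?thesis using p by (simp add: \<kappa>_def)
qed

theorem theorem6p4:
  fixes d :: nat and p :: "complex poly"
  assumes "d \<ge> 2"
  shows "(infinitely_divisible p \<and> degree p = d \<and>
            finite_free_cumulant p 1 = 0 \<and> finite_free_cumulant p 2 = 1) \<longleftrightarrow>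
         p = smult (of_real (real d powr (- real d / 2)))
               (pcompose (hermite_poly d) [:0, of_real (sqrt (real d)):])"
    (is "?L \<longleftrightarrow> p = ?H")
proof -
  have H: "?H = gen_hermite (1 / of_nat d) d" using assms by (intro rescaled_hermite_poly) simp
  show ?thesis unfolding H
  proof
    assume L: ?L
    have "finite_free_cumulant p n = (if n = 2 then 1 else 0)" if "n \<in> {1..d}" for n
    proof -
      \<comment> \<open>Orders 1 and 2 are prescribed; all others fall under the limit argument,
        whose index is one less than the order.\<close>
      have "n = 1 \<or> n = 2 \<or> n = Suc (n - 1) \<and> 2 \<le> n - 1 \<and> n - 1 < d"
        using that by auto
      then show ?thesis
        using L assms infinitely_divisible_higher_cumulants[of p d "n - 1"] by auto
    qed
    then show "p = gen_hermite (1 / of_nat d) d"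
      using L assms by (intro gaussian_cumulants_imp_gen_hermite) (auto simp: infinitely_divisible_def)
  next
    assume "p = gen_hermite (1 / of_nat d) d"
    \<comment> \<open>Variance \<open>1 / d\<close> corresponds to second cumulant 1.\<close>
    then show ?L
      using assms infinitely_divisible_gen_hermite[of d "1 / real d"]
        gen_hermite_cumulants[of d 1 1] gen_hermite_cumulants[of d 2 1]
      by (auto simp: degree_gen_hermite)
  qed
qed

end
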